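(* Let $n$ be a positive integer with $n\equiv 3\pmod{4}$. Then, modulo $\Phi_n(q)^2\Phi_{n^2}(q)^2$, \[ \sum_{k=0}^{(n^2-1)/2}\frac{(1+q^{4k+1})(q^2;q^4)_k^3}{(1+q)(q^4;q^4)_k^3}q^k \equiv \frac{[n^2]_{q^2}(q^3;q^4)_{(n^2-1)/2}}{(q^5;q^4)_{(n^2-1)/2}}\, q^{(1-n^2)/2}, \] and \[ \sum_{k=0}^{n^2-1}\frac{(1+q^{4k+1})(q^2;q^4)_k^3}{(1+q)(q^4;q^4)_k^3}q^k \equiv \frac{[n^2]_{q^2}(q^3;q^4)_{(n^2-1)/2}}{(q^5;q^4)_{(n^2-1)/2}}\, q^{(1-n^2)/2}. \]
   Context: The $q$-shifted factorial is $(a;q)_0=1$ and $(a;q)_k=(1-a)(1-aq)\cdots(1-aq^{k-1})$ for $k\geqslant 1$. The $q$-integer is $[N]_q=1+q+\cdots+q^{N-1}$, so $[N]_{q^2}=1+q^2+\cdots+q^{2(N-1)}$. $\Phi_N(q)$ denotes the $N$-th cyclotomic polynomial. For rational functions $A(q),B(q)$, $A(q)\equiv B(q)\pmod{P(q)}$ means that $A(q)-B(q)=P(q)\,U(q)/V(q)$ with polynomials $U,V$ and $V(q)$ relatively prime to $P(q)$. *)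

theory Defs
  imports Complex_Main "HOL-Computational_Algebra.Computational_Algebra"
    "HOL-Number_Theory.Number_Theory"
begin

definition q_shifted :: "'a::comm_ring_1 \<Rightarrow> 'a \<Rightarrow> nat \<Rightarrow> 'a" where
  "q_shifted a q k = (\<Prod>i<k. 1 - a * q ^ i)"

definition q_integer :: "nat \<Rightarrow> 'a::comm_ring_1 \<Rightarrow> 'a" where
  "q_integer N q = (\<Sum>i<N. q ^ i)"

definition cyclotomic :: "nat \<Rightarrow> complex poly" where
  "cyclotomic N = (\<Prod>k\<in>{k\<in>{1..N}. coprime k N}. [:- cis (2 * pi * real k / real N), 1:])"

definition qvar :: "complex poly fract" where
  "qvar = to_fract [:0, 1:]"

text \<open>
  The congruence is taken in the whole field of rational functions, so \<open>A\<close> and \<open>B\<close>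
  need not themselves have denominators prime to \<open>P\<close>.
\<close>
definition ratfun_cong ::
  "complex poly fract \<Rightarrow> complex poly fract \<Rightarrow> complex poly \<Rightarrow> bool" where
  "ratfun_cong A B P \<longleftrightarrow>
     (\<exists>U V. V \<noteq> 0 \<and> coprime V P \<and> A - B = to_fract P * to_fract U / to_fract V)"

end

theory Submission
  imports Defs "HOL-Computational_Algebra.Field_as_Ring"
begin

text \<open>
  Deform the summand by a parameter \<open>x\<close>, replacing two of the three factors \<open>(q\<^sup>2;q\<^sup>4)\<^sub>k / (q\<^sup>4;q\<^sup>4)\<^sub>k\<close> by
  \<open>(x q\<^sup>2;q\<^sup>4)\<^sub>k (q\<^sup>2/x;q\<^sup>4)\<^sub>k / ((x q\<^sup>4;q\<^sup>4)\<^sub>k (q\<^sup>4/x;q\<^sup>4)\<^sub>k)\<close>. For \<open>x = q\<^bsup>2N\<^esup>\<close> with \<open>N\<close> odd the deformed sum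
  terminates and equals \<open>[N] (q\<^sup>3;q\<^sup>4)\<^sub>m / (q\<^sup>5;q\<^sup>4)\<^sub>m q\<^bsup>-m\<^esup>\<close> (\<open>[N]\<close> being taken at \<open>q\<^sup>2\<close>), \<open>m = (N-1)/2\<close>, by a WZ-type
  recurrence in \<open>x\<close>. After clearing denominators the deformed sum is a polynomial in \<open>y = x + 1/x\<close> whose
  coefficients are regular at each primitive root of unity \<open>\<zeta>\<close>.

  At \<open>\<zeta>\<close> of order \<open>n\<^sup>2\<close> the single node \<open>N = n\<^sup>2\<close> suffices: its distance \<open>2 - y\<close> from \<open>x = 1\<close> vanishes to
  order two. At \<open>\<zeta>\<close> of order \<open>n\<close> both sides vanish to order two: the nodes \<open>N = n, 3n, ..., J n\<close> have
  closed forms vanishing to order two because \<open>n \<equiv> 3 (mod 4)\<close>, and interpolating through all of them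
  compensates the zeros of the denominator. The choices \<open>J = n\<close> and \<open>J = 2n - 1\<close> give the two sums up
  to terms that vanish to order three.
\<close>

section \<open>A terminating summation\<close>

lemma q_shifted_0 [simp]: "q_shifted a q 0 = 1"
  by (simp add: q_shifted_def)

lemma q_shifted_Suc: "q_shifted a q (Suc k) = q_shifted a q k * (1 - a * q ^ k)"
  by (simp add: q_shifted_def)

lemma q_shifted_Suc_shift: "q_shifted a q (Suc k) = (1 - a) * q_shifted (a * q) q k"
  by (simp add: q_shifted_def prod.lessThan_Suc_shift mult.assoc del: prod.lessThan_Suc)

lemma q_shifted_eq_0_iff:
  fixes a q :: "'a::idom"
  shows "q_shifted a q k = 0 \<longleftrightarrow> (\<exists>i<k. a * q ^ i = 1)"
  by (auto simp: q_shifted_def)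

lemma q_integer_eq:
  fixes q :: "'a::field"
  assumes "q \<noteq> 1"
  shows "q_integer N q = (1 - q ^ N) / (1 - q)"
  using assms by (simp add: q_integer_def sum_gp_strict)

locale q_not_root_of_unity =
  fixes q :: "'a::field"
  assumes q_nz: "q \<noteq> 0"
    and q_power_ne_1: "0 < e \<Longrightarrow> q ^ e \<noteq> 1"
begin

abbreviation qf :: "'a \<Rightarrow> nat \<Rightarrow> 'a" where
  "qf a k \<equiv> q_shifted a (q ^ 4) k"

lemma q_power_eq_iff: "q ^ a = q ^ b \<longleftrightarrow> a = b"
proof -
  have "a = b" if "q ^ a = q ^ b" "a \<le> b" for a b
  proof (rule ccontr)
    assume "a \<noteq> b"
    moreover have "q ^ b = q ^ a * q ^ (b - a)"
      using that(2) by (simp flip: power_add)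
    ultimately show False
      using that q_nz q_power_ne_1[of "b - a"] by auto
  qed
  from this[of a b] this[of b a] show ?thesis
    by (cases "a \<le> b") auto
qed

lemma one_minus_q_power_ne_0: "0 < e \<Longrightarrow> 1 - q ^ e \<noteq> 0"
  using q_power_ne_1[of e] by simp

lemma one_plus_q_ne_0: "1 + q \<noteq> 0"
  using one_minus_q_power_ne_0[of 2] by (auto simp: power2_eq_square algebra_simps add_eq_0_iff)

lemma qf_q_power_ne_0: "0 < e \<Longrightarrow> qf (q ^ e) k \<noteq> 0"
  by (auto simp: q_shifted_eq_0_iff q_power_ne_1 simp flip: power_mult power_add)

section \<open>The deformed summand, its recurrence in \<open>x\<close> and its closed form\<close>

definition outer :: "nat \<Rightarrow> 'a" where
  "outer k = (1 + q ^ (4 * k + 1)) * qf (q ^ 2) k / ((1 + q) * qf (q ^ 4) k) * q ^ k"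

text \<open>
  The general term of a very-well-poised \<open>6\<phi>5\<close> series in base \<open>q\<^sup>4\<close> with parameters
  \<open>q\<^sup>2, q, x q\<^sup>2, q\<^sup>2 / x\<close>; it specialises to the summand of the theorem at \<open>x = 1\<close> and
  terminates at \<open>x = q\<^bsup>4m+2\<^esup>\<close>.
\<close>
definition summand :: "'a \<Rightarrow> nat \<Rightarrow> 'a" where
  "summand x k = outer k * (qf (x * q ^ 2) k * qf (q ^ 2 / x) k)
                   / (qf (x * q ^ 4) k * qf (q ^ 4 / x) k)"

text \<open>The factor between consecutive closed forms, written in
  \<open>x = q ^ (4 * m + 2)\<close>; the sum must pick it up when \<open>x\<close> becomes
  \<open>x * q ^ 4\<close>.\<close>

definition shift_ratio :: "'a \<Rightarrow> 'a" where
  "shift_ratio x = (1 - x * q ^ 4) * (1 - x * q) / ((1 - x) * (1 - x * q ^ 3) * q)"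

text \<open>The WZ partner, recording the defect of that recurrence for partial sums. Its factor
  \<open>qf (q ^ 2 / x) k\<close> kills it once the series in \<open>x\<close> has
  terminated.\<close>

definition certificate :: "'a \<Rightarrow> nat \<Rightarrow> 'a" where
  "certificate x k =
     - ((1 - q) * (1 - x\<^sup>2 * q ^ 4)) / (q * (1 - x) * (1 - x * q ^ 3))
     * (q ^ k * qf (q ^ 6) k * qf (x * q ^ 6) k * qf (q ^ 2 / x) k
        / (qf (q ^ 4) k * qf (x * q ^ 8) k * qf (q ^ 4 / x) k))"

lemma outer_0 [simp]: "outer 0 = 1"
  using one_plus_q_ne_0 by (simp add: outer_def)

text \<open>The telescoping step with \<open>K\<close> for \<open>q ^ (4 * k)\<close>, after
  division by the part common to all terms. \<open>L\<close> and \<open>R\<close> bring the two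
  sides over one denominator.\<close>

lemma certificate_step:
  fixes x K :: 'a
  assumes "q \<noteq> 0" "x \<noteq> 0" "1 + q \<noteq> 0" "1 - x \<noteq> 0" "1 - x * q ^ 3 \<noteq> 0" "1 - x * q ^ 4 \<noteq> 0"
    "1 - q ^ 4 * K \<noteq> 0" "1 - x * q ^ 8 * K \<noteq> 0" "x - q ^ 4 * K \<noteq> 0"
  shows "- ((1 - q) * (1 - x\<^sup>2 * q ^ 4)) / (q * (1 - x) * (1 - x * q ^ 3))
     * (q * (1 - q ^ 6 * K) * (1 - x * q ^ 6 * K) * (1 - q ^ 2 / x * K)
         / ((1 - q ^ 4 * K) * (1 - x * q ^ 8 * K) * (1 - q ^ 4 / x * K)) - 1)
   = q * (1 + q ^ 5 * K) * (1 - q ^ 2) / ((1 + q) * (1 - q ^ 4 * K))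
     * ((1 - x * q ^ 6 * K) * (1 - 1 / (x * q ^ 2)) / ((1 - x * q ^ 8 * K) * (1 - 1 / x))
        - shift_ratio x * ((1 - x * q ^ 2) * (1 - q ^ 2 / x * K))
            / ((1 - x * q ^ 4) * (1 - q ^ 4 / x * K)))"
proof -
  define d where "d = x - q ^ 4 * K"
  define a where "a = 1 - x"
  define b where "b = 1 - x * q ^ 3"
  define e where "e = 1 - q ^ 4 * K"
  define f where "f = 1 - x * q ^ 8 * K"
  define g where "g = 1 - x * q ^ 4"
  note defs = d_def a_def b_def e_def f_def g_def
  have nz: "d \<noteq> 0" "a \<noteq> 0" "b \<noteq> 0" "e \<noteq> 0" "f \<noteq> 0" "g \<noteq> 0"
    using assms by (simp_all add: defs)
  have r: "1 - q ^ 4 / x * K = d / x" "1 - q ^ 2 / x * K = (x - q ^ 2 * K) / x"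
     "1 - 1 / (x * q ^ 2) = (x * q ^ 2 - 1) / (x * q ^ 2)" "1 - 1 / x = - a / x"
    using assms by (simp_all add: field_simps defs)
  have L: "- ((1 - q) * (1 - x\<^sup>2 * q ^ 4)) / (q * a * b)
     * (q * (1 - q ^ 6 * K) * (1 - x * q ^ 6 * K) * ((x - q ^ 2 * K) / x)
         / (e * f * (d / x)) - 1)
    = - ((1 - q) * (1 - x\<^sup>2 * q ^ 4)) *
     (q * (1 - q ^ 6 * K) * (1 - x * q ^ 6 * K) * (x - q ^ 2 * K) - e * f * d) / (q * a * b * e * f * d)"
    using nz assms(1-2) by (simp add: field_simps)
  have R: "q * (1 + q ^ 5 * K) * (1 - q ^ 2) / ((1 + q) * e)
     * ((1 - x * q ^ 6 * K) * ((x * q ^ 2 - 1) / (x * q ^ 2)) / (f * (- a / x))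
        - g * (1 - x * q) / (a * b * q) * ((1 - x * q ^ 2) * ((x - q ^ 2 * K) / x))
            / (g * (d / x)))
    = (1 + q ^ 5 * K) * (1 - q) * (1 - x * q ^ 2) *
      ((1 - x * q ^ 6 * K) * b * d - (1 - x * q) * (x - q ^ 2 * K) * q * f)
      / (q * a * b * e * f * d)"
  proof -
    have 1: "q * (1 + q ^ 5 * K) * (1 - q ^ 2) / ((1 + q) * e) = q * (1 + q ^ 5 * K) * (1 - q) / e"
    proof -
      have "(1 - q ^ 2) / (1 + q) = 1 - q"
        using assms(3) by (simp add: divide_simps) (simp add: algebra_simps power2_eq_square)
      thus ?thesis by (metis times_divide_eq_left times_divide_eq_right divide_divide_eq_left)
    qed
    have 2: "(1 - x * q ^ 6 * K) * ((x * q ^ 2 - 1) / (x * q ^ 2)) / (f * (- a / x))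
      = (1 - x * q ^ 6 * K) * (1 - x * q ^ 2) / (q ^ 2 * f * a)"
      using assms(1-2) nz by (simp add: field_simps)
    have 3: "g * (1 - x * q) / (a * b * q) * ((1 - x * q ^ 2) * ((x - q ^ 2 * K) / x)) / (g * (d / x))
      = (1 - x * q) * (1 - x * q ^ 2) * (x - q ^ 2 * K) / (a * b * q * d)"
      using assms(1-2) nz by (simp add: field_simps)
    have 4: "q * s / e * (u * v / (q ^ 2 * f * a) - w * v * z / (a * b * q * d))
       = s * v * (u * b * d - w * z * q * f) / (q * a * b * e * f * d)" for s u v w z
      using assms(1) nz by (simp add: field_simps power2_eq_square)
    show ?thesis
      unfolding 1 2 3 using 4[of "(1 + q ^ 5 * K) * (1 - q)"] by (simp add: mult.assoc)
  qed
  have "- ((1 - q) * (1 - x\<^sup>2 * q ^ 4)) *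
     (q * (1 - q ^ 6 * K) * (1 - x * q ^ 6 * K) * (x - q ^ 2 * K) - e * f * d) =
     (1 + q ^ 5 * K) * (1 - q) * (1 - x * q ^ 2) *
      ((1 - x * q ^ 6 * K) * b * d - (1 - x * q) * (x - q ^ 2 * K) * q * f)"
  proof -
    \<comment> \<open>Both numerators share \<open>(1 - q) * (1 - x * q ^ 2)\<close>; the rest is a
      polynomial identity.\<close>
    have "- ((1 + x * q ^ 2) * (q * (1 - q ^ 6 * K) * (1 - x * q ^ 6 * K) * (x - q ^ 2 * K) - e * f * d))
       = (1 + q ^ 5 * K) *
        ((1 - x * q ^ 6 * K) * b * d - (1 - x * q) * (x - q ^ 2 * K) * q * f)"
      unfolding defs by (simp add: algebra_simps power_numeral_reduce)
    moreover have "1 - x\<^sup>2 * q ^ 4 = (1 - x * q ^ 2) * (1 + x * q ^ 2)"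
      by (simp add: algebra_simps power2_eq_square eval_nat_numeral)
    moreover have "- (\<alpha> * (\<beta> * \<gamma>)) * \<delta> = \<epsilon> * \<alpha> * \<beta> * \<phi>" if "- (\<gamma> * \<delta>) = \<epsilon> * \<phi>"
      for \<alpha> \<beta> \<gamma> \<delta> \<epsilon> \<phi> :: 'a
    proof -
      have "- (\<alpha> * (\<beta> * \<gamma>)) * \<delta> = \<alpha> * \<beta> * (- (\<gamma> * \<delta>))"
        by (simp add: mult_ac)
      thus ?thesis
        unfolding that by (simp only: mult_ac)
    qed
    ultimately show ?thesis by simp
  qed
  thus ?thesis
    unfolding r shift_ratio_def defs[symmetric] L R by simp
qed

lemma summand_partial_sum:
  assumes x: "x \<noteq> 0" "\<And>e. x * q ^ e \<noteq> 1" "\<And>i. x \<noteq> q ^ (4 * i)"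
  shows "(\<Sum>k\<le>K. summand (x * q ^ 4) k) - shift_ratio x * (\<Sum>k\<le>K. summand x k)
         = certificate x K"
proof (induction K)
  case 0
  have nz: "1 - x \<noteq> 0" "1 - x * q ^ 3 \<noteq> 0"
    using x(2)[of 0] x(2)[of 3] by auto
  have "1 - shift_ratio x = - ((1 - q) * (1 - x\<^sup>2 * q ^ 4)) / (q * (1 - x) * (1 - x * q ^ 3))"
    using nz q_nz unfolding shift_ratio_def
    by (simp add: divide_simps) (simp add: algebra_simps eval_nat_numeral)
  then show ?case
    by (simp add: summand_def certificate_def)
next
  case (Suc k)
  define K where "K = (q ^ 4) ^ k"
  define A where "A = qf (x * q ^ 6) k"
  define B where "B = qf (q ^ 2 / x) k"
  define C where "C = qf (x * q ^ 8) k"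
  define D where "D = qf (q ^ 4 / x) k"
  define E where "E = qf (q ^ 4) k"
  define U where "U = qf (q ^ 6) k"
  define X where "X = q ^ k * U * A * B / (E * C * D)"
  define c where "c = - ((1 - q) * (1 - x\<^sup>2 * q ^ 4)) / (q * (1 - x) * (1 - x * q ^ 3))"
  \<comment> \<open>\<open>S\<close> splits off the last factor of a product and \<open>T\<close>
    the first; together they reduce the products at \<open>Suc k\<close> to those collected in
    \<open>X\<close>.\<close>
  note S = q_shifted_Suc[of _ "q ^ 4" k, folded K_def]
  note T = q_shifted_Suc_shift[of _ "q ^ 4" k]
  have s1: "qf (q ^ 2) (Suc k) = (1 - q ^ 2) * U"
    by (simp add: T U_def flip: power_add)
  have s2: "qf (x * q ^ 2) (Suc k) = (1 - x * q ^ 2) * A"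
    by (simp add: T A_def mult.assoc flip: power_add)
  have s3: "qf (x * q ^ 4) (Suc k) = (1 - x * q ^ 4) * C"
    by (simp add: T C_def mult.assoc flip: power_add)
  have s4: "qf (1 / (x * q ^ 2)) (Suc k) = (1 - 1 / (x * q ^ 2)) * B"
  proof -
    have "1 / (x * q ^ 2) * q ^ 4 = q ^ 2 / x"
      using q_nz x(1) by (simp add: field_simps flip: power_add)
    thus ?thesis by (simp add: T B_def)
  qed
  have s5: "qf (1 / x) (Suc k) = (1 - 1 / x) * D"
    by (simp add: T D_def)
  have o: "outer (Suc k) = q ^ k * U / E * (q * (1 + q ^ 5 * K) * (1 - q ^ 2) / ((1 + q) * (1 - q ^ 4 * K)))"
  proof -
    have "q ^ (4 * Suc k + 1) = q ^ 5 * K"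
      by (simp add: K_def flip: power_mult power_add)
    thus ?thesis unfolding outer_def s1 S[of "q ^ 4"] E_def[symmetric]
      by (simp add: mult_ac)
  qed
  have f1: "summand x (Suc k) = X * (q * (1 + q ^ 5 * K) * (1 - q ^ 2) / ((1 + q) * (1 - q ^ 4 * K))
       * ((1 - x * q ^ 2) * (1 - q ^ 2 / x * K) / ((1 - x * q ^ 4) * (1 - q ^ 4 / x * K))))"
    unfolding summand_def o s2 s3 X_def
    by (simp add: S B_def[symmetric] D_def[symmetric] mult_ac)
  have arg: "x * q ^ 4 * q ^ 2 = x * q ^ 6" "x * q ^ 4 * q ^ 4 = x * q ^ 8"
     "q ^ 2 / (x * q ^ 4) = 1 / (x * q ^ 2)" "q ^ 4 / (x * q ^ 4) = 1 / x"
    using q_nz x(1) by (simp_all add: mult.assoc field_simps flip: power_add)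
  have f2: "summand (x * q ^ 4) (Suc k) = X * (q * (1 + q ^ 5 * K) * (1 - q ^ 2) / ((1 + q) * (1 - q ^ 4 * K))
       * ((1 - x * q ^ 6 * K) * (1 - 1 / (x * q ^ 2)) / ((1 - x * q ^ 8 * K) * (1 - 1 / x))))"
    unfolding summand_def arg o s4 s5 X_def
    by (simp add: S A_def[symmetric] C_def[symmetric] mult_ac)
  have p1: "certificate x k = c * X"
    by (simp add: certificate_def c_def X_def U_def A_def B_def C_def D_def E_def)
  have p2: "certificate x (Suc k) = c * (X * (q * (1 - q ^ 6 * K) * (1 - x * q ^ 6 * K) * (1 - q ^ 2 / x * K)
         / ((1 - q ^ 4 * K) * (1 - x * q ^ 8 * K) * (1 - q ^ 4 / x * K))))"
    unfolding certificate_def c_def[symmetric] X_def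
    by (simp add: S A_def[symmetric] B_def[symmetric] C_def[symmetric] D_def[symmetric]
        E_def[symmetric] U_def[symmetric] mult_ac)
  have KK: "q ^ j * K = q ^ (j + 4 * k)" for j
    by (simp add: K_def power_add flip: power_mult)
  have nz: "1 - x \<noteq> 0" "1 - x * q ^ 3 \<noteq> 0" "1 - x * q ^ 4 \<noteq> 0" "1 - x * q ^ 8 * K \<noteq> 0"
    "1 - q ^ 4 * K \<noteq> 0" "x - q ^ 4 * K \<noteq> 0"
    using x(2)[of 0] x(2)[of 3] x(2)[of 4] x(2)[of "8 + 4 * k"] x(3)[of "Suc k"] q_power_ne_1[of "4 + 4 * k"]
    by (auto simp: KK mult.assoc)
  have key: "c * (q * (1 - q ^ 6 * K) * (1 - x * q ^ 6 * K) * (1 - q ^ 2 / x * K)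
         / ((1 - q ^ 4 * K) * (1 - x * q ^ 8 * K) * (1 - q ^ 4 / x * K)) - 1)
   = q * (1 + q ^ 5 * K) * (1 - q ^ 2) / ((1 + q) * (1 - q ^ 4 * K))
     * ((1 - x * q ^ 6 * K) * (1 - 1 / (x * q ^ 2)) / ((1 - x * q ^ 8 * K) * (1 - 1 / x))
        - shift_ratio x * ((1 - x * q ^ 2) * (1 - q ^ 2 / x * K))
            / ((1 - x * q ^ 4) * (1 - q ^ 4 / x * K)))"
    unfolding c_def by (rule certificate_step) (use nz q_nz one_plus_q_ne_0 x(1) in auto)
  have "certificate x (Suc k) - certificate x k =
      X * (c * (q * (1 - q ^ 6 * K) * (1 - x * q ^ 6 * K) * (1 - q ^ 2 / x * K)
         / ((1 - q ^ 4 * K) * (1 - x * q ^ 8 * K) * (1 - q ^ 4 / x * K)) - 1))"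
  proof -
    have "\<alpha> * (\<beta> * \<gamma>) - \<alpha> * \<beta> = \<beta> * (\<alpha> * (\<gamma> - 1))" for \<alpha> \<beta> \<gamma> :: 'a
      by (simp add: algebra_simps)
    thus ?thesis unfolding p1 p2 .
  qed
  also have "\<dots> = summand (x * q ^ 4) (Suc k) - shift_ratio x * summand x (Suc k)"
  proof -
    have "\<alpha> * (\<beta> * (\<gamma> - \<delta> * \<epsilon> / \<phi>)) = \<alpha> * (\<beta> * \<gamma>) - \<delta> * (\<alpha> * (\<beta> * (\<epsilon> / \<phi>)))" for \<alpha> \<beta> \<gamma> \<delta> \<epsilon> \<phi> :: 'a
      by (simp add: algebra_simps)
    thus ?thesis unfolding key f1 f2 .
  qed
  finally show ?case
    using Suc by (simp add: algebra_simps)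
qed

lemma qf_terminating:
  assumes "m < k"
  shows "qf (q ^ 2 / q ^ (4 * m + 2)) k = 0"
proof -
  have "q ^ 2 / q ^ (4 * m + 2) * (q ^ 4) ^ m = 1"
    using q_nz by (simp add: field_simps flip: power_mult power_add)
  thus ?thesis
    using assms unfolding q_shifted_eq_0_iff by blast
qed

lemma summand_beyond: "m < k \<Longrightarrow> summand (q ^ (4 * m + 2)) k = 0"
  unfolding summand_def by (simp only: qf_terminating mult_zero_right div_0)

text \<open>The right-hand side of the theorem with \<open>N = 2 * m + 1\<close> in place of
  \<open>n\<^sup>2\<close>; dividing by \<open>q ^ m\<close> gives the power with exponent (1 -
  N)/2.\<close>

definition closed_form :: "nat \<Rightarrow> 'a" where
  "closed_form m = q_integer (2 * m + 1) (q ^ 2) * qf (q ^ 3) m / qf (q ^ 5) m / q ^ m"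

lemma q_integer_q2: "q_integer N (q ^ 2) = (1 - q ^ (2 * N)) / (1 - q ^ 2)"
  using q_integer_eq[of "q ^ 2" N] q_power_ne_1[of 2] by (simp add: power_mult)

lemma closed_form_Suc: "closed_form (Suc m) = shift_ratio (q ^ (4 * m + 2)) * closed_form m"
proof -
  define x where "x = q ^ (4 * m + 2)"
  have e: "q ^ (2 * (2 * m + 1)) = x" "q ^ (2 * (2 * Suc m + 1)) = x * q ^ 4"
     "q ^ 3 * (q ^ 4) ^ m = x * q" "q ^ 5 * (q ^ 4) ^ m = x * q ^ 3"
  proof -
    show "q ^ (2 * (2 * m + 1)) = x"
      unfolding x_def q_power_eq_iff by simp
    show "q ^ (2 * (2 * Suc m + 1)) = x * q ^ 4"
      unfolding x_def power_add[symmetric] q_power_eq_iff by simp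
    show "q ^ 5 * (q ^ 4) ^ m = x * q ^ 3"
      unfolding x_def power_mult[symmetric] power_add[symmetric] q_power_eq_iff by simp
    have "q ^ 3 * (q ^ 4) ^ m = x * q ^ 1"
      unfolding x_def power_mult[symmetric] power_add[symmetric] q_power_eq_iff by simp
    thus "q ^ 3 * (q ^ 4) ^ m = x * q" by simp
  qed
  have nz: "1 - x \<noteq> 0" "1 - x * q ^ 3 \<noteq> 0" "1 - q ^ 2 \<noteq> 0" "qf (q ^ 5) m \<noteq> 0"
  proof -
    show "1 - x \<noteq> 0" "1 - q ^ 2 \<noteq> 0"
      unfolding x_def by (rule one_minus_q_power_ne_0; simp)+
    have "x * q ^ 3 = q ^ (4 * m + 5)"
      unfolding x_def power_add[symmetric] q_power_eq_iff by simp
    thus "1 - x * q ^ 3 \<noteq> 0"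
      using one_minus_q_power_ne_0[of "4 * m + 5"] by simp
    show "qf (q ^ 5) m \<noteq> 0"
      by (rule qf_q_power_ne_0) simp
  qed
  show ?thesis
    unfolding closed_form_def q_integer_q2 e q_shifted_Suc x_def[symmetric] shift_ratio_def
    using nz(1) by (simp add: mult_ac)
qed

text \<open>Raising \<open>m\<close> by one moves \<open>x\<close> to \<open>x * q ^ 4\<close> and
  multiplies both sides by \<open>shift_ratio x\<close>. The upper limit \<open>M\<close> is free
  because terms beyond \<open>m\<close> vanish.\<close>

lemma sum_summand:
  "m \<le> M \<Longrightarrow> (\<Sum>k\<le>M. summand (q ^ (4 * m + 2)) k) = closed_form m"
proof (induction m arbitrary: M)
  have cut: "(\<Sum>k\<le>M. summand (q ^ (4 * m + 2)) k) = (\<Sum>k\<le>m. summand (q ^ (4 * m + 2)) k)"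
    if "m \<le> M" for m M
    using that by (intro sum.mono_neutral_right) (auto intro!: summand_beyond simp del: power_Suc power_add_numeral2 add_2_eq_Suc')
  {
    case 0
    have "(\<Sum>k\<le>0. summand (q ^ (4 * 0 + 2)) k) = closed_form 0"
      by (simp add: summand_def closed_form_def q_integer_def)
    with cut[of 0 M] show ?case by simp
  next
    case (Suc m)
    define x where "x = q ^ (4 * m + 2)"
    have x: "x \<noteq> 0" "x * q ^ e \<noteq> 1" "x \<noteq> q ^ (4 * i)" for e i
    proof -
      show "x \<noteq> 0" using q_nz by (simp add: x_def)
      show "x * q ^ e \<noteq> 1" using q_power_ne_1[of "4 * m + 2 + e"] by (simp add: x_def power_add mult_ac)
      have "4 * m + 2 \<noteq> 4 * i" by presburger
      thus "x \<noteq> q ^ (4 * i)" unfolding x_def q_power_eq_iff .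
    qed
    have x4: "q ^ (4 * Suc m + 2) = x * q ^ 4"
      unfolding x_def power_add[symmetric] q_power_eq_iff by simp
    \<comment> \<open>At the limit \<open>Suc m\<close> the certificate contains the zero factor of
      index \<open>m\<close>, so the recurrence becomes exact.\<close>
    have "qf (q ^ 2 / x) (Suc m) = 0"
      unfolding x_def by (rule qf_terminating) simp
    hence "(\<Sum>k\<le>Suc m. summand (x * q ^ 4) k) = shift_ratio x * (\<Sum>k\<le>Suc m. summand x k)"
      using summand_partial_sum[OF x, of "Suc m"] by (simp add: certificate_def)
    also have "\<dots> = closed_form (Suc m)"
      using Suc.IH[of "Suc m"] by (simp add: closed_form_Suc x_def)
    finally show ?case
      using cut[OF Suc.prems] unfolding x4 by simp
  }
qed

end

section \<open>Orders in a local ring\<close>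

text \<open>A stand-in for the local ring at a point with uniformizer \<open>t\<close>. Orders of
  vanishing are expressed by membership in \<open>V\<close>, without constructing a
  valuation.\<close>

locale local_subring =
  fixes V :: "'a::field set" and t :: 'a
  assumes one_mem: "1 \<in> V"
    and add_mem: "\<And>f g. f \<in> V \<Longrightarrow> g \<in> V \<Longrightarrow> f + g \<in> V"
    and mult_mem: "\<And>f g. f \<in> V \<Longrightarrow> g \<in> V \<Longrightarrow> f * g \<in> V"
    and uminus_mem: "\<And>f. f \<in> V \<Longrightarrow> - f \<in> V"
    and t_mem: "t \<in> V"
    and t_nz: "t \<noteq> 0"
begin

lemma zero_mem: "0 \<in> V"
  using add_mem[OF one_mem uminus_mem[OF one_mem]] by simp

lemma diff_mem: "f \<in> V \<Longrightarrow> g \<in> V \<Longrightarrow> f - g \<in> V"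
  using add_mem[OF _ uminus_mem, of f g] by simp

lemma power_mem: "f \<in> V \<Longrightarrow> f ^ k \<in> V"
  by (induction k) (auto intro: one_mem mult_mem)

lemma sum_mem: "(\<And>i. i \<in> A \<Longrightarrow> f i \<in> V) \<Longrightarrow> sum f A \<in> V"
  by (induction A rule: infinite_finite_induct) (auto intro: zero_mem add_mem)

definition ordge :: "nat \<Rightarrow> 'a \<Rightarrow> bool" where
  "ordge k f \<longleftrightarrow> f / t ^ k \<in> V"

definition ordeq :: "nat \<Rightarrow> 'a \<Rightarrow> bool" where
  "ordeq k f \<longleftrightarrow> f \<noteq> 0 \<and> f / t ^ k \<in> V \<and> t ^ k / f \<in> V"

lemma ordge_0_iff: "ordge 0 f \<longleftrightarrow> f \<in> V"
  by (simp add: ordge_def)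

lemma ordge_zero: "ordge k 0"
  by (simp add: ordge_def zero_mem)

lemma ordeq_0_one: "ordeq 0 1"
  by (simp add: ordeq_def one_mem)

lemma ordeq_imp_ordge: "ordeq k f \<Longrightarrow> ordge k f"
  by (simp add: ordge_def ordeq_def)

lemma ordge_add: "ordge k f \<Longrightarrow> ordge k g \<Longrightarrow> ordge k (f + g)"
  by (simp add: ordge_def add_divide_distrib add_mem)

lemma ordge_diff: "ordge k f \<Longrightarrow> ordge k g \<Longrightarrow> ordge k (f - g)"
  by (simp add: ordge_def diff_divide_distrib diff_mem)

lemma ordge_sum: "(\<And>i. i \<in> A \<Longrightarrow> ordge k (f i)) \<Longrightarrow> ordge k (sum f A)"
  by (simp add: ordge_def sum_divide_distrib sum_mem)

lemma ordge_mult: "ordge j f \<Longrightarrow> ordge k g \<Longrightarrow> ordge (j + k) (f * g)"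
  using mult_mem[of "f / t ^ j" "g / t ^ k"] by (simp add: ordge_def power_add)

lemma ordeq_mult: "ordeq j f \<Longrightarrow> ordeq k g \<Longrightarrow> ordeq (j + k) (f * g)"
  using mult_mem[of "f / t ^ j" "g / t ^ k"] mult_mem[of "t ^ j / f" "t ^ k / g"]
  by (simp add: ordeq_def power_add mult_ac)

lemma ordeq_uminus: "ordeq k f \<Longrightarrow> ordeq k (- f)"
  using uminus_mem by (simp add: ordeq_def)

lemma ordge_mono:
  assumes "ordge k f" "j \<le> k"
  shows "ordge j f"
proof -
  have "t ^ k = t ^ j * t ^ (k - j)"
    using assms(2) by (simp flip: power_add)
  hence "f / t ^ j = f / t ^ k * t ^ (k - j)"
    using t_nz by simp
  thus ?thesis
    using assms(1) unfolding ordge_def by (metis mult_mem power_mem t_mem)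
qed

lemma ordge_divide: "ordge (j + k) f \<Longrightarrow> ordeq j g \<Longrightarrow> ordge k (f / g)"
  using mult_mem[of "f / t ^ (j + k)" "t ^ j / g"] t_nz by (simp add: ordge_def ordeq_def power_add mult_ac)

lemma ordeq_divide: "ordeq (j + k) f \<Longrightarrow> ordeq j g \<Longrightarrow> ordeq k (f / g)"
  using mult_mem[of "f / t ^ (j + k)" "t ^ j / g"] mult_mem[of "t ^ (j + k) / f" "g / t ^ j"] t_nz
  by (simp add: ordeq_def power_add mult_ac)

lemma ordge_prod: "(\<And>i. i \<in> A \<Longrightarrow> ordge (c i) (f i)) \<Longrightarrow> ordge (sum c A) (prod f A)"
  by (induction A rule: infinite_finite_induct) (auto intro: ordge_mult simp: ordge_0_iff one_mem)

lemma ordeq_prod: "(\<And>i. i \<in> A \<Longrightarrow> ordeq (c i) (f i)) \<Longrightarrow> ordeq (sum c A) (prod f A)"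
  by (induction A rule: infinite_finite_induct) (auto intro: ordeq_mult simp: ordeq_0_one)

section \<open>Polynomials with coefficients in the local ring\<close>

definition integral_poly :: "'a poly \<Rightarrow> bool" where
  "integral_poly p \<longleftrightarrow> (\<forall>i. poly.coeff p i \<in> V)"

lemma integral_poly_pCons: "integral_poly (pCons a p) \<longleftrightarrow> a \<in> V \<and> integral_poly p"
  unfolding integral_poly_def by (metis coeff_pCons_0 coeff_pCons_Suc nat.exhaust)

lemma integral_poly_0: "integral_poly 0"
  by (simp add: integral_poly_def zero_mem)

lemma integral_poly_diff: "integral_poly p \<Longrightarrow> integral_poly r \<Longrightarrow> integral_poly (p - r)"
  by (simp add: integral_poly_def diff_mem)

lemma integral_poly_smult: "c \<in> V \<Longrightarrow> integral_poly p \<Longrightarrow> integral_poly (Polynomial.smult c p)"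
  by (simp add: integral_poly_def mult_mem)

lemma integral_poly_mult: "integral_poly p \<Longrightarrow> integral_poly r \<Longrightarrow> integral_poly (p * r)"
  by (simp add: integral_poly_def Polynomial.coeff_mult mult_mem sum_mem)

lemma integral_poly_sum: "(\<And>i. i \<in> A \<Longrightarrow> integral_poly (f i)) \<Longrightarrow> integral_poly (sum f A)"
  by (simp add: integral_poly_def Polynomial.coeff_sum sum_mem)

lemma integral_poly_prod: "(\<And>i. i \<in> A \<Longrightarrow> integral_poly (f i)) \<Longrightarrow> integral_poly (prod f A)"
  by (induction A rule: infinite_finite_induct)
    (auto intro: integral_poly_mult simp: integral_poly_pCons integral_poly_0 one_mem
      simp flip: pCons_one)

lemma poly_mem: "integral_poly p \<Longrightarrow> x \<in> V \<Longrightarrow> poly p x \<in> V"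
  by (induction p) (auto simp: integral_poly_pCons zero_mem intro: add_mem mult_mem)

text \<open>Horner's scheme only adds and multiplies, so division by a monic linear factor keeps the
  coefficients in \<open>V\<close>.\<close>

lemma integral_poly_synthetic_div:
  "integral_poly p \<Longrightarrow> x \<in> V \<Longrightarrow> integral_poly (synthetic_div p x)"
  by (induction p) (auto simp: integral_poly_pCons integral_poly_0 poly_mem)

text \<open>
  Newton interpolation: subtracting the value at one node and dividing by the corresponding linear
  factor costs exactly the two orders that the factor regains at the target point.
\<close>
lemma ordge_poly_interpolation:
  assumes "finite I" "integral_poly p" "x \<in> V"
    and "\<And>i. i \<in> I \<Longrightarrow> y i \<in> V"
    and "\<And>i. i \<in> I \<Longrightarrow> ordge 2 (x - y i)"
    and "\<And>i j. i \<in> I \<Longrightarrow> j \<in> I \<Longrightarrow> i \<noteq> j \<Longrightarrow> ordeq 2 (y i - y j)"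
    and "\<And>i. i \<in> I \<Longrightarrow> ordge (2 * card I) (poly p (y i))"
  shows "ordge (2 * card I) (poly p x)"
  using assms
proof (induction I arbitrary: p rule: finite_induct)
  case empty
  then show ?case by (simp add: ordge_0_iff poly_mem)
next
  case (insert a I)
  define g where "g = synthetic_div p (y a)"
  have pg: "poly p z = (z - y a) * poly g z + poly p (y a)" for z
  proof -
    have "poly p z = poly ([:- y a, 1:] * g + [:poly p (y a):]) z"
      unfolding g_def synthetic_div_correct' ..
    thus ?thesis by (simp add: algebra_simps)
  qed
  have card: "2 * card (insert a I) = 2 + 2 * card I"
    using insert.hyps by simp
  have "ordge (2 * card I) (poly g x)"
  proof (rule insert.IH)
    show "integral_poly g"
      unfolding g_def using insert.prems by (intro integral_poly_synthetic_div) auto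
    fix i assume i: "i \<in> I"
    hence eq: "ordeq 2 (y i - y a)"
      using insert.prems(5)[of i a] insert.hyps by auto
    have "ordge (2 + 2 * card I) (poly p (y i) - poly p (y a))"
      using insert.prems(6)[of i] insert.prems(6)[of a] i unfolding card by (intro ordge_diff) auto
    hence "ordge (2 * card I) ((poly p (y i) - poly p (y a)) / (y i - y a))"
      using eq by (rule ordge_divide)
    also have "(poly p (y i) - poly p (y a)) / (y i - y a) = poly g (y i)"
      using pg[of "y i"] eq by (simp add: ordeq_def)
    finally show "ordge (2 * card I) (poly g (y i))" .
  qed (use insert.prems in auto)
  hence "ordge (2 + 2 * card I) ((x - y a) * poly g x)"
    using insert.prems(4)[of a] by (intro ordge_mult) auto
  moreover have "ordge (2 + 2 * card I) (poly p (y a))"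
    using insert.prems(6)[of a] unfolding card by simp
  ultimately show ?case
    unfolding card pg[of x] by (rule ordge_add)
qed

end

section \<open>Counting indices in a residue class\<close>

lemma card_less_mod_eq:
  fixes n r k :: nat
  assumes "r < n"
  shows "card {i \<in> {..<k}. i mod n = r} = (k + (n - 1 - r)) div n"
proof (induction k)
  case 0
  then show ?case using assms by simp
next
  case (Suc k)
  have "{i \<in> {..<Suc k}. i mod n = r} =
      (if k mod n = r then insert k {i \<in> {..<k}. i mod n = r} else {i \<in> {..<k}. i mod n = r})"
    by (auto simp: less_Suc_eq)
  \<comment> \<open>The quotient by \<open>n\<close> grows exactly when this remainder is zero,
    which is when \<open>k\<close> itself is counted.\<close>
  moreover have "(Suc k + (n - 1 - r)) mod n = 0 \<longleftrightarrow> k mod n = r"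
  proof -
    have "(Suc k + (n - 1 - r)) mod n = (k mod n + (n - r)) mod n"
    proof -
      have "Suc k + (n - 1 - r) = k + (n - r)" using assms by simp
      thus ?thesis by (metis mod_add_left_eq)
    qed
    moreover have "k mod n < n" using assms by simp
    ultimately show ?thesis
      using assms by (cases "k mod n < r") (auto simp: le_mod_geq)
  qed
  ultimately show ?case
    using Suc by (simp add: div_Suc)
qed

text \<open>As \<open>n\<close> is odd, 4 is invertible modulo \<open>n\<close>, so the condition on
  \<open>i\<close> singles out one residue class, that of \<open>r\<close>.\<close>

lemma card_less_dvd:
  fixes n r k c :: nat
  assumes "odd n" "r < n" "n dvd 4 * r + c"
  shows "card {i \<in> {..<k}. n dvd 4 * i + c} = (k + (n - 1 - r)) div n"
proof -
  have "n dvd 4 * i + c \<longleftrightarrow> i mod n = r" for i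
  proof -
    have cop: "coprime n 4"
      using assms(1) coprime_power_right_iff[of n 2 2] by simp
    have "n dvd 4 * i + c \<longleftrightarrow> [4 * i + c = 4 * r + c] (mod n)"
      using assms(3) by (simp add: cong_def dvd_eq_mod_eq_0)
    also have "\<dots> \<longleftrightarrow> [i = r] (mod n)"
      using cop by (simp add: cong_add_rcancel_nat cong_mult_lcancel_nat coprime_commute)
    finally show ?thesis
      using assms(2) by (simp add: cong_def)
  qed
  thus ?thesis
    using card_less_mod_eq[OF assms(2)] by simp
qed

section \<open>The deformed sum near a root of unity\<close>

text \<open>The order condition says that \<open>q\<close> specialises to a primitive
  \<open>n\<close>-th root of unity, where each \<open>1 - q ^ e\<close> has at most a simple zero.
  Both \<open>n\<close> and \<open>n\<^sup>2\<close> of the theorem take the role of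
  \<open>n\<close>, so no residue modulo 4 is fixed.\<close>

locale cyclotomic_place = q_not_root_of_unity q + local_subring V t
  for q :: "'a::field" and V :: "'a set" and t :: 'a +
  fixes n :: nat
  assumes odd_n: "odd n"
    and n_ge_3: "3 \<le> n"
    and q_mem: "q \<in> V"
    and inverse_q_mem: "1 / q \<in> V"
    and ordeq_one_minus_q_power: "\<And>e. 0 < e \<Longrightarrow> ordeq (if n dvd e then 1 else 0) (1 - q ^ e)"
begin

lemma inverse_q_power_mem: "1 / q ^ k \<in> V"
  using power_mem[OF inverse_q_mem, of k] by (simp add: power_one_over)

lemma ordeq_q_power: "ordeq 0 (q ^ k)"
  using q_nz by (simp add: ordeq_def inverse_q_power_mem power_mem q_mem)

lemma two_mem: "2 \<in> V"
  using add_mem[OF one_mem one_mem] by simp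

lemma ordge_one_minus_q_power: "n dvd e \<Longrightarrow> ordge 1 (1 - q ^ e)"
  using ordeq_one_minus_q_power[of e] by (cases "e = 0") (auto simp: ordge_zero ordeq_imp_ordge)

lemma one_minus_q_power_mem: "1 - q ^ e \<in> V"
  by (intro diff_mem one_mem power_mem q_mem)

lemma not_n_dvd_2: "\<not> n dvd 2"
  using n_ge_3 by (auto dest: dvd_imp_le)

lemma ordeq_one_plus_q: "ordeq 0 (1 + q)"
proof -
  have "ordeq (0 + 0) (1 - q ^ 2)" "ordeq 0 (1 - q ^ 1)"
    using ordeq_one_minus_q_power[of 2] ordeq_one_minus_q_power[of 1] not_n_dvd_2 n_ge_3 by auto
  hence "ordeq 0 ((1 - q ^ 2) / (1 - q ^ 1))"
    by (rule ordeq_divide)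
  also have "(1 - q ^ 2) / (1 - q ^ 1) = 1 + q"
    using one_minus_q_power_ne_0[of 1]
    by (simp add: divide_simps) (simp add: algebra_simps power2_eq_square)
  finally show ?thesis .
qed

text \<open>For positive \<open>c\<close> this is the order of \<open>qf (q ^ c) k\<close> at the
  place, as its factors vanish at most simply.\<close>

definition cnt :: "nat \<Rightarrow> nat \<Rightarrow> nat" where
  "cnt c k = card {i \<in> {..<k}. n dvd 4 * i + c}"

lemma sum_if_dvd: "(\<Sum>i<k. if n dvd 4 * i + c then d else 0) = d * cnt c k"
  by (simp add: cnt_def sum.If_cases Int_def conj_commute)

lemma ordeq_qf:
  assumes "0 < c"
  shows "ordeq (cnt c k) (qf (q ^ c) k)"
proof -
  have "ordeq (\<Sum>i<k. if n dvd 4 * i + c then 1 else 0) (\<Prod>i<k. 1 - q ^ (4 * i + c))"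
    using assms by (intro ordeq_prod ordeq_one_minus_q_power) simp
  thus ?thesis
    using sum_if_dvd[of c 1 k] by (simp add: q_shifted_def power_add mult.commute flip: power_mult)
qed

lemma cnt_2: "cnt 2 k = (k + (n - 1) div 2) div n"
proof -
  obtain h where h: "n = 2 * h + 1" using odd_n by (auto elim: oddE)
  show ?thesis
  proof -
    have "4 * h + 2 = n * 2" by (simp add: h)
    hence "n dvd 4 * h + 2" by simp
    moreover have "n - 1 - h = (n - 1) div 2" "h < n" by (simp_all add: h)
    ultimately show ?thesis
      unfolding cnt_def using odd_n card_less_dvd[of n h 2 k] by metis
  qed
qed

lemma cnt_4: "cnt 4 k = k div n"
  unfolding cnt_def using odd_n n_ge_3 card_less_dvd[of n "n - 1" 4 k] by (simp add: algebra_simps)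

lemma ordge_half_ratio:
  assumes "cnt 4 k + d \<le> cnt 2 k"
  shows "ordge d (qf (q ^ 2) k / qf (q ^ 4) k)"
  using assms by (intro ordge_divide[OF _ ordeq_qf] ordge_mono[OF ordeq_imp_ordge[OF ordeq_qf]]) auto

lemma outer_eq: "outer k = (1 + q ^ (4 * k + 1)) * q ^ k / (1 + q) * (qf (q ^ 2) k / qf (q ^ 4) k)"
  by (simp add: outer_def)

lemma outer_factor_mem: "(1 + q ^ (4 * k + 1)) * q ^ k / (1 + q) \<in> V"
proof -
  have "ordge (0 + 0) ((1 + q ^ (4 * k + 1)) * q ^ k)"
    unfolding add_0 ordge_0_iff by (intro mult_mem add_mem one_mem power_mem q_mem)
  thus ?thesis
    unfolding ordge_0_iff[symmetric] using ordeq_one_plus_q by (rule ordge_divide)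
qed

text \<open>In each block of \<open>n\<close> indices the numerator's zero, at residue
  \<open>(n - 1) div 2\<close>, precedes the denominator's, at \<open>n - 1\<close>; so the quotient
  has no pole.\<close>

lemma outer_mem: "outer k \<in> V"
proof -
  have "cnt 4 k \<le> cnt 2 k"
    unfolding cnt_2 cnt_4 by (intro div_le_mono) simp
  hence "qf (q ^ 2) k / qf (q ^ 4) k \<in> V"
    using ordge_half_ratio[of k 0] by (simp add: ordge_0_iff)
  thus ?thesis
    unfolding outer_eq using outer_factor_mem by (intro mult_mem)
qed

text \<open>Past the middle of a block the numerator has met its zero and the denominator has not.
  The quotient enters cubed, giving order at least three.\<close>

lemma ordge_summand_tail:
  assumes "(n - 1) div 2 < k mod n"
  shows "ordge 2 (summand 1 k)"
proof -
  define r where "r = qf (q ^ 2) k / qf (q ^ 4) k"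
  have k: "k = n * (k div n) + k mod n" by simp
  have "k + (n - 1) div 2 \<ge> n * (k div n) + n"
  proof -
    have "n \<le> k mod n + (n - 1) div 2"
      using assms odd_n by (elim oddE) simp
    thus ?thesis using k by linarith
  qed
  hence "n * (k div n + 1) div n \<le> (k + (n - 1) div 2) div n"
    by (intro div_le_mono) simp
  hence "cnt 4 k + 1 \<le> cnt 2 k"
    using n_ge_3 unfolding cnt_2 cnt_4 by simp
  hence r: "ordge 1 r"
    unfolding r_def by (rule ordge_half_ratio)
  have "ordge (0 + (1 + (1 + 1))) ((1 + q ^ (4 * k + 1)) * q ^ k / (1 + q) * (r * (r * r)))"
    using outer_factor_mem r by (intro ordge_mult) (simp_all add: ordge_0_iff)
  also have "(1 + q ^ (4 * k + 1)) * q ^ k / (1 + q) * (r * (r * r)) = summand 1 k"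
    by (simp add: summand_def outer_eq r_def mult.assoc)
  finally show ?thesis
    by (rule ordge_mono) simp
qed

text \<open>
  The factors \<open>(1 - x q\<^sup>e) (1 - q\<^sup>e / x)\<close> of the summand are linear in \<open>x + 1 / x\<close>.
\<close>
definition lin :: "nat \<Rightarrow> 'a poly" where
  "lin e = [:1 + q ^ (2 * e), - (q ^ e):]"

lemma poly_lin: "x \<noteq> 0 \<Longrightarrow> poly (lin e) (x + 1 / x) = (1 - x * q ^ e) * (1 - q ^ e / x)"
  by (simp add: lin_def power_add mult_2) (simp add: field_simps)

text \<open>\<open>den_poly\<close> is the common denominator of the deformed terms in
  \<open>x + 1 / x\<close>, and \<open>sum_poly\<close> the matching numerator: term
  \<open>k\<close> is multiplied by the factors it lacks.\<close>

definition den_poly :: "nat \<Rightarrow> 'a poly" where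
  "den_poly M = (\<Prod>i<M. lin (4 * i + 4))"

definition sum_poly :: "nat \<Rightarrow> 'a poly" where
  "sum_poly M = (\<Sum>k\<le>M. Polynomial.smult (outer k) ((\<Prod>i<k. lin (4 * i + 2)) * (\<Prod>i=k..<M. lin (4 * i + 4))))"

lemma integral_lin: "integral_poly (lin e)"
  unfolding lin_def
  by (auto simp: integral_poly_pCons integral_poly_0 intro!: add_mem one_mem power_mem q_mem uminus_mem)

lemma integral_den_poly: "integral_poly (den_poly M)"
  unfolding den_poly_def by (intro integral_poly_prod integral_lin)

lemma integral_sum_poly: "integral_poly (sum_poly M)"
  unfolding sum_poly_def
  by (intro integral_poly_sum integral_poly_smult outer_mem integral_poly_mult
      integral_poly_prod integral_lin)

lemma prod_lin:
  assumes "x \<noteq> 0"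
  shows "(\<Prod>i<k. poly (lin (4 * i + e)) (x + 1 / x)) = qf (x * q ^ e) k * qf (q ^ e / x) k"
proof -
  have "(\<Prod>i<k. poly (lin (4 * i + e)) (x + 1 / x)) =
      (\<Prod>i<k. (1 - x * q ^ e * (q ^ 4) ^ i) * (1 - q ^ e / x * (q ^ 4) ^ i))"
    by (intro prod.cong refl, subst poly_lin[OF assms])
      (simp add: power_add mult_ac flip: power_mult)
  thus ?thesis by (simp add: prod.distrib q_shifted_def)
qed

lemma poly_den_poly:
  "x \<noteq> 0 \<Longrightarrow> poly (den_poly M) (x + 1 / x) = qf (x * q ^ 4) M * qf (q ^ 4 / x) M"
  by (simp add: den_poly_def poly_prod prod_lin)

lemma poly_sum_poly:
  assumes x: "x \<noteq> 0" and nz: "poly (den_poly M) (x + 1 / x) \<noteq> 0"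
  shows "poly (sum_poly M) (x + 1 / x) = poly (den_poly M) (x + 1 / x) * (\<Sum>k\<le>M. summand x k)"
proof -
  have "outer k * ((\<Prod>i<k. poly (lin (4 * i + 2)) (x + 1 / x)) *
            (\<Prod>i=k..<M. poly (lin (4 * i + 4)) (x + 1 / x)))
      = poly (den_poly M) (x + 1 / x) * summand x k" if k: "k \<le> M" for k
  proof -
    define a where "a = (\<Prod>i<k. poly (lin (4 * i + 4)) (x + 1 / x))"
    define b where "b = (\<Prod>i=k..<M. poly (lin (4 * i + 4)) (x + 1 / x))"
    have ab: "poly (den_poly M) (x + 1 / x) = a * b"
      unfolding den_poly_def poly_prod a_def b_def
      using prod.atLeastLessThan_concat[of 0 k M "\<lambda>i. poly (lin (4 * i + 4)) (x + 1 / x)"] k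
      by (simp add: lessThan_atLeast0)
    have "a \<noteq> 0" using nz unfolding ab by simp
    moreover have "summand x k = outer k * (\<Prod>i<k. poly (lin (4 * i + 2)) (x + 1 / x)) / a"
      unfolding summand_def a_def prod_lin[OF x] ..
    ultimately show ?thesis
      unfolding ab b_def[symmetric] by simp
  qed
  thus ?thesis
    unfolding sum_poly_def by (simp add: poly_sum poly_prod sum_distrib_left)
qed

text \<open>The value 2 is \<open>x + 1 / x\<close> at \<open>x = 1\<close>, where the summand of
  the theorem reappears.\<close>

lemma den_poly_at_2: "poly (den_poly M) 2 = qf (q ^ 4) M * qf (q ^ 4) M"
  using poly_den_poly[of 1 M] by simp

lemma sum_summand_1: "(\<Sum>k\<le>M. summand 1 k) = poly (sum_poly M) 2 / poly (den_poly M) 2"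
  using poly_sum_poly[of 1 M] qf_q_power_ne_0[of 4 M] by (simp add: den_poly_at_2)

text \<open>A zero would make a positive power of \<open>q\<close> equal to 1 or equate the
  exponents \<open>4 * i + 4\<close> and \<open>4 * m + 2\<close>, which differ modulo 4.\<close>

lemma den_poly_node_ne_0:
  "poly (den_poly M) (q ^ (4 * m + 2) + 1 / q ^ (4 * m + 2)) \<noteq> 0"
proof -
  have "4 + 4 * i \<noteq> 4 * m + 2" for i
    by presburger
  hence "q ^ (4 + 4 * i) \<noteq> q ^ (4 * m + 2)" for i
    by (simp only: q_power_eq_iff) simp
  hence "q ^ 4 / q ^ (4 * m + 2) * (q ^ 4) ^ i \<noteq> 1" for i
    using q_nz by (simp add: divide_simps power_add flip: power_mult)
  moreover have "q ^ (4 * m + 2) * q ^ 4 * (q ^ 4) ^ i \<noteq> 1" for i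
    using q_power_ne_1[of "4 * m + 2 + 4 + 4 * i"]
    unfolding power_mult[symmetric] power_add[symmetric] by simp
  ultimately show ?thesis
    using q_nz by (subst poly_den_poly) (auto simp: q_shifted_eq_0_iff)
qed

lemma poly_sum_poly_node:
  assumes "m \<le> M"
  shows "poly (sum_poly M) (q ^ (4 * m + 2) + 1 / q ^ (4 * m + 2)) =
    poly (den_poly M) (q ^ (4 * m + 2) + 1 / q ^ (4 * m + 2)) * closed_form m"
  using poly_sum_poly[OF _ den_poly_node_ne_0, of m M] sum_summand[OF assms] q_nz by simp

section \<open>Orders of vanishing at the nodes\<close>

lemma node_mem: "q ^ e + 1 / q ^ e \<in> V"
  by (intro add_mem power_mem q_mem inverse_q_power_mem)

text \<open>With \<open>w = q ^ e\<close> the difference is \<open>- (1 - w) ^ 2 / w\<close>; the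
  square doubles the order.\<close>

lemma ordge_two_minus_node:
  assumes "n dvd e"
  shows "ordge 2 (2 - (q ^ e + 1 / q ^ e))"
proof -
  have "ordge (1 + 1 + 0) ((1 - q ^ e) * (1 - q ^ e) * (- (1 / q ^ e)))"
    using assms by (intro ordge_mult ordge_one_minus_q_power)
      (auto simp: ordge_0_iff intro: uminus_mem inverse_q_power_mem)
  also have "(1 - q ^ e) * (1 - q ^ e) * (- (1 / q ^ e)) = 2 - (q ^ e + 1 / q ^ e)"
    using q_nz by (simp add: field_simps)
  finally show ?thesis by (simp add: numeral_2_eq_2)
qed

text \<open>For \<open>a < b\<close> the difference is, up to a unit, \<open>1 - q ^ (b - a)\<close>
  times \<open>1 - q ^ (a + b)\<close>, and both exponents are positive multiples of
  \<open>n\<close>.\<close>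

lemma ordeq_node_diff:
  assumes "n dvd a" "n dvd b" "0 < a" "a \<noteq> b"
  shows "ordeq 2 ((q ^ a + 1 / q ^ a) - (q ^ b + 1 / q ^ b))"
proof -
  have less: "ordeq 2 ((q ^ a + 1 / q ^ a) - (q ^ b + 1 / q ^ b))"
    if "n dvd a" "n dvd b" "a < b" for a b
  proof -
    have "ordeq 1 (1 - q ^ (b - a))" "ordeq 1 (1 - q ^ (a + b))"
      using that ordeq_one_minus_q_power[of "b - a"] ordeq_one_minus_q_power[of "a + b"] by auto
    hence "ordeq (0 + (1 + 1)) (- ((1 - q ^ (b - a)) * (1 - q ^ (a + b))))"
      by (intro ordeq_uminus) (use ordeq_mult in force)
    hence "ordeq 2 (- ((1 - q ^ (b - a)) * (1 - q ^ (a + b))) / q ^ b)"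
      using ordeq_divide[OF _ ordeq_q_power[of b], of "1 + 1"] by (metis one_add_one)
    also have "- ((1 - q ^ (b - a)) * (1 - q ^ (a + b))) / q ^ b =
        (q ^ a + 1 / q ^ a) - (q ^ b + 1 / q ^ b)"
    proof -
      have b: "q ^ b = q ^ a * q ^ (b - a)"
        using that(3) by (simp flip: power_add)
      show ?thesis
        unfolding power_add b using q_nz by (simp add: field_simps)
    qed
    finally show ?thesis .
  qed
  show ?thesis
  proof (cases "a < b")
    case True
    then show ?thesis using less assms by blast
  next
    case False
    hence "ordeq 2 (- ((q ^ b + 1 / q ^ b) - (q ^ a + 1 / q ^ a)))"
      using assms by (intro ordeq_uminus less) auto
    then show ?thesis by simp
  qed
qed

text \<open>At \<open>x = q ^ e\<close> both \<open>1 - x * q ^ a\<close> and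
  \<open>1 - q ^ a / x\<close> vanish when \<open>n\<close> divides \<open>a\<close>, so each of the
  \<open>cnt 4 M\<close> relevant factors counts twice.\<close>

lemma ordge_den_poly_node:
  assumes "n dvd e"
  shows "ordge (2 * cnt 4 M) (poly (den_poly M) (q ^ e + 1 / q ^ e))"
proof -
  have one: "ordge (if n dvd a then 1 else 0) (1 - q ^ a / q ^ e)" for a
  proof -
    \<comment> \<open>The numerator is split into two known factors because \<open>a - e\<close> may
      be negative.\<close>
    have "ordge (0 + (if n dvd a then 1 else 0)) ((1 - q ^ a) - (1 - q ^ e))"
    proof (cases "n dvd a")
      case True
      have "ordge 1 ((1 - q ^ a) - (1 - q ^ e))"
        using True assms by (intro ordge_diff ordge_one_minus_q_power)
      with True show ?thesis by simp
    next
      case False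
      have "(1 - q ^ a) - (1 - q ^ e) \<in> V"
        by (intro diff_mem one_minus_q_power_mem)
      with False show ?thesis by (simp add: ordge_0_iff)
    qed
    hence "ordge (if n dvd a then 1 else 0) (((1 - q ^ a) - (1 - q ^ e)) / q ^ e)"
      using ordeq_q_power by (rule ordge_divide)
    also have "((1 - q ^ a) - (1 - q ^ e)) / q ^ e = 1 - q ^ a / q ^ e"
      using q_nz by (simp add: field_simps)
    finally show ?thesis .
  qed
  have two: "ordge (if n dvd a then 1 else 0) (1 - q ^ e * q ^ a)" for a
    using assms ordge_one_minus_q_power[of "e + a"] one_minus_q_power_mem[of "e + a"]
    by (auto simp: power_add ordge_0_iff dvd_add)
  have "ordge (if n dvd a then 2 else 0) (poly (lin a) (q ^ e + 1 / q ^ e))" for a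
    using ordge_mult[OF two[of a] one[of a]] q_nz by (subst poly_lin) (auto simp: eval_nat_numeral)
  hence "ordge (\<Sum>i<M. if n dvd 4 * i + 4 then 2 else 0)
      (\<Prod>i<M. poly (lin (4 * i + 4)) (q ^ e + 1 / q ^ e))"
    by (intro ordge_prod)
  thus ?thesis
    by (simp only: sum_if_dvd den_poly_def poly_prod)
qed

lemma ordge_q_integer:
  assumes "n dvd N"
  shows "ordge 1 (q_integer N (q ^ 2))"
proof -
  have "ordge (0 + 1) (1 - q ^ (2 * N))" "ordeq 0 (1 - q ^ 2)"
    using assms ordge_one_minus_q_power[of "2 * N"] ordeq_one_minus_q_power[of 2] not_n_dvd_2 by auto
  thus ?thesis
    unfolding q_integer_q2 by (rule ordge_divide)
qed

text \<open>The \<open>q\<close>-integer supplies one order, \<open>qf (q ^ 3) m\<close> adds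
  \<open>cnt 3 m\<close>, and division by \<open>qf (q ^ 5) m\<close> costs
  \<open>cnt 5 m\<close>.\<close>

lemma ordge_closed_form:
  assumes "n dvd 2 * m + 1" "cnt 5 m + d \<le> 1 + cnt 3 m"
  shows "ordge d (closed_form m)"
proof -
  have "ordge (1 + cnt 3 m) (q_integer (2 * m + 1) (q ^ 2) * qf (q ^ 3) m)"
    using assms by (intro ordge_mult ordge_q_integer ordeq_imp_ordge ordeq_qf) auto
  hence "ordge (cnt 5 m + (0 + d)) (q_integer (2 * m + 1) (q ^ 2) * qf (q ^ 3) m)"
    by (rule ordge_mono) (use assms in simp)
  hence "ordge (0 + d) (q_integer (2 * m + 1) (q ^ 2) * qf (q ^ 3) m / qf (q ^ 5) m)"
    by (rule ordge_divide) (simp add: ordeq_qf)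
  thus ?thesis
    unfolding closed_form_def using ordeq_q_power by (rule ordge_divide)
qed

text \<open>For \<open>n = 4 * v + 3\<close> the zeros of \<open>qf (q ^ 3)\<close> sit at residue
  \<open>v\<close> and those of \<open>qf (q ^ 5)\<close> at \<open>3 * v + 1\<close>. The
  \<open>2 * v + 1\<close> indices after \<open>h\<close> full blocks catch only the former, a
  surplus of one; the \<open>q\<close>-integer gives the second order.\<close>

lemma ordge_closed_form_3_mod_4:
  assumes "n mod 4 = 3"
  shows "ordge 2 (closed_form (h * n + (n - 1) div 2))"
proof -
  obtain v where v: "n = 4 * v + 3"
    using assms by (metis mult_div_mod_eq)
  define m where "m = h * n + (n - 1) div 2"
  have m: "m = h * n + (2 * v + 1)" by (simp add: m_def v)
  have "cnt 3 m = (m + (n - 1 - v)) div n"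
    unfolding cnt_def using odd_n by (intro card_less_dvd) (auto simp: v)
  also have "m + (n - 1 - v) = (h + 1) * n + v"
    by (simp add: m v algebra_simps)
  also have "\<dots> div n = h + 1"
    by (subst div_mult_self3) (auto simp: v)
  finally have 3: "cnt 3 m = h + 1" .
  have "4 * (3 * v + 1) + 5 = 3 * n" by (simp add: v)
  hence "n dvd 4 * (3 * v + 1) + 5" by simp
  hence "cnt 5 m = (m + (n - 1 - (3 * v + 1))) div n"
    unfolding cnt_def using odd_n by (intro card_less_dvd) (simp_all add: v)
  also have "m + (n - 1 - (3 * v + 1)) = h * n + (3 * v + 2)"
    by (simp add: m v algebra_simps)
  also have "\<dots> div n = h"
    by (subst div_mult_self3) (auto simp: v)
  finally have 5: "cnt 5 m = h" .
  have "2 * m + 1 = (2 * h + 1) * n"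
    by (simp add: m v algebra_simps)
  hence "n dvd 2 * m + 1" by simp
  thus ?thesis
    using 3 5 unfolding m_def[symmetric] by (intro ordge_closed_form) auto
qed

text \<open>
  The denominator has order \<open>2 * H\<close> at \<open>x = 1\<close>, and the \<open>H + 1\<close> nodes give the numerator order
  \<open>2 * (H + 1)\<close> there.
\<close>
lemma ordge_sum_3_mod_4:
  assumes "n mod 4 = 3"
  shows "ordge 2 (\<Sum>k\<le>H * n + (n - 1) div 2. summand 1 k)"
proof -
  define m where "m h = h * n + (n - 1) div 2" for h
  define M where "M = m H"
  define y where "y h = q ^ (4 * m h + 2) + 1 / q ^ (4 * m h + 2)" for h
  have e: "4 * m h + 2 = (4 * h + 2) * n" for h
    using odd_n by (auto simp: m_def algebra_simps elim!: oddE)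
  have cnt: "cnt 4 M = H"
    using n_ge_3 unfolding cnt_4 M_def m_def by (subst div_mult_self3) auto
  have "ordge (2 * card {..H}) (poly (sum_poly M) 2)"
  proof (rule ordge_poly_interpolation[where y = y])
    fix h assume h: "h \<in> {..H}"
    show "y h \<in> V"
      unfolding y_def by (rule node_mem)
    show "ordge 2 (2 - y h)"
      unfolding y_def e by (intro ordge_two_minus_node) simp
    \<comment> \<open>The denominator contributes \<open>2 * H\<close> orders and the closed form
      two more: twice the number of nodes.\<close>
    have "ordge (2 * cnt 4 M + 2) (poly (den_poly M) (y h) * closed_form (m h))"
      unfolding y_def using assms unfolding m_def[symmetric] e
      by (intro ordge_mult ordge_den_poly_node ordge_closed_form_3_mod_4[folded m_def]) auto
    moreover have "m h \<le> M"
      using h by (simp add: M_def m_def)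
    ultimately show "ordge (2 * card {..H}) (poly (sum_poly M) (y h))"
      unfolding y_def by (simp only: poly_sum_poly_node cnt) simp
  next
    fix h h' assume "h \<in> {..H}" "h' \<in> {..H}" "h \<noteq> h'"
    thus "ordeq 2 (y h - y h')"
      unfolding y_def e using n_ge_3 by (intro ordeq_node_diff) auto
  qed (use integral_sum_poly two_mem in auto)
  hence "ordge (cnt 4 M + cnt 4 M + 2) (poly (sum_poly M) 2)"
    by (simp add: cnt mult_2)
  hence "ordge 2 (poly (sum_poly M) 2 / poly (den_poly M) 2)"
    unfolding den_poly_at_2 by (rule ordge_divide) (intro ordeq_mult ordeq_qf; simp)
  thus ?thesis
    unfolding sum_summand_1[symmetric] M_def m_def .
qed

text \<open>With fewer than \<open>n\<close> factors the denominator has no zero at the place, so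
  the single node \<open>N = n\<close> suffices. Subtracting the closed form times
  \<open>den_poly\<close> makes the polynomial vanish at that node.\<close>

lemma ordge_sum_1_mod_4:
  assumes "n mod 4 = 1"
  shows "ordge 2 ((\<Sum>k\<le>(n - 1) div 2. summand 1 k) - closed_form ((n - 1) div 2))"
proof -
  obtain v where v: "n = 4 * v + 5"
  proof -
    have "n = 4 * (n div 4 - 1) + 5"
      using assms n_ge_3 by presburger
    thus ?thesis using that by blast
  qed
  define m where "m = (n - 1) div 2"
  have m: "m = 2 * v + 2" "2 * m + 1 = n" by (simp_all add: m_def v)
  define c where "c = closed_form m"
  define y where "y = q ^ (4 * m + 2) + 1 / q ^ (4 * m + 2)"
  have e: "4 * m + 2 = 2 * n" using m(2) by simp
  \<comment> \<open>Since \<open>4 * v + 5 = n\<close>, the product \<open>qf (q ^ 5) m\<close> has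
    one zero; the \<open>q\<close>-integer cancels it, so \<open>c\<close> lies in
    \<open>V\<close>.\<close>
  have "cnt 5 m = (m + (n - 1 - v)) div n"
    unfolding cnt_def using odd_n by (intro card_less_dvd) (auto simp: v)
  also have "m + (n - 1 - v) = 1 * n + (v + 1)"
    by (simp add: m v)
  also have "\<dots> div n = 1"
    by (subst div_mult_self3) (auto simp: v)
  finally have "ordge 0 c"
    unfolding c_def using m(2) by (intro ordge_closed_form) auto
  hence c: "c \<in> V" by (simp add: ordge_0_iff)
  define p where "p = sum_poly m - Polynomial.smult c (den_poly m)"
  have "poly p y = 0"
    unfolding p_def y_def using poly_sum_poly_node[of m m] by (simp add: c_def)
  have "ordge (2 * card {()}) (poly p 2)"
  proof (rule ordge_poly_interpolation[where y = "\<lambda>_. y"])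
    show "integral_poly p"
      unfolding p_def
      by (intro integral_poly_diff integral_poly_smult integral_sum_poly integral_den_poly c)
    show "y \<in> V"
      unfolding y_def by (rule node_mem)
    show "ordge 2 (2 - y)"
      unfolding y_def e by (intro ordge_two_minus_node) simp
    show "ordge (2 * card {()}) (poly p y)"
      using \<open>poly p y = 0\<close> by (simp add: ordge_zero)
  qed (auto simp: two_mem)
  moreover have "cnt 4 m = 0"
    unfolding cnt_4 using m(2) by simp
  ultimately have "ordge (cnt 4 m + cnt 4 m + 2) (poly p 2)"
    by (simp add: numeral_2_eq_2)
  hence "ordge 2 (poly p 2 / poly (den_poly m) 2)"
    unfolding den_poly_at_2 by (rule ordge_divide) (intro ordeq_mult ordeq_qf; simp)
  also have "poly p 2 / poly (den_poly m) 2 = (\<Sum>k\<le>m. summand 1 k) - c"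
    using qf_q_power_ne_0[of 4 m]
    by (simp add: p_def sum_summand_1 diff_divide_distrib den_poly_at_2)
  finally show ?thesis
    unfolding m_def c_def .
qed

lemma ordge_sum_extend:
  assumes "ordge 2 ((\<Sum>k\<le>M. summand 1 k) - c)" "M \<le> L"
    and "\<And>k. M < k \<Longrightarrow> k \<le> L \<Longrightarrow> (n - 1) div 2 < k mod n"
  shows "ordge 2 ((\<Sum>k\<le>L. summand 1 k) - c)"
proof -
  have "(\<Sum>k\<le>L. summand 1 k) = (\<Sum>k\<le>M. summand 1 k) + (\<Sum>k\<in>{M<..L}. summand 1 k)"
    using assms(2) by (subst sum.union_disjoint[symmetric]) (auto intro!: sum.cong)
  moreover have "ordge 2 (\<Sum>k\<in>{M<..L}. summand 1 k)"
    using assms(3) by (intro ordge_sum ordge_summand_tail) auto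
  ultimately show ?thesis
    using ordge_add[OF assms(1)] by (metis add.commute add_diff_eq)
qed

end

section \<open>Rational functions\<close>

definition place :: "complex \<Rightarrow> complex poly fract set" where
  "place z = {to_fract a / to_fract b | a b. poly b z \<noteq> 0}"

lemma placeI: "poly b z \<noteq> 0 \<Longrightarrow> f = to_fract a / to_fract b \<Longrightarrow> f \<in> place z"
  by (auto simp: place_def)

lemma local_subring_place: "local_subring (place z) (to_fract [:- z, 1:])"
proof
  show "1 \<in> place z"
    by (rule placeI[of 1 _ _ 1]) simp_all
  show "to_fract [:- z, 1:] \<in> place z"
    by (rule placeI[of 1 _ _ "[:- z, 1:]"]) simp_all
  show "to_fract [:- z, 1:] \<noteq> 0"
    by simp
  fix f assume "f \<in> place z"
  then obtain a b where f: "poly b z \<noteq> 0" "f = to_fract a / to_fract b"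
    by (auto simp: place_def)
  show "- f \<in> place z"
    using f by (intro placeI[of b _ _ "- a"]) auto
  fix g assume "g \<in> place z"
  then obtain c d where g: "poly d z \<noteq> 0" "g = to_fract c / to_fract d"
    by (auto simp: place_def)
  show "f * g \<in> place z"
    using f g by (intro placeI[of "b * d" _ _ "a * c"]) auto
  have "to_fract b \<noteq> 0" "to_fract d \<noteq> 0"
    using f g by auto
  thus "f + g \<in> place z"
    using f g by (intro placeI[of "b * d" _ _ "a * d + c * b"]) (auto simp: add_frac_eq)
qed

lemma to_fract_power: "to_fract (p ^ k) = to_fract p ^ k"
  by (induction k) simp_all

lemma qvar_power: "qvar ^ k = to_fract (Polynomial.monom 1 k)"
  by (simp add: qvar_def monom_altdef to_fract_power)

lemma q_not_root_of_unity_qvar: "q_not_root_of_unity qvar"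
proof
  show "qvar \<noteq> 0" by (simp add: qvar_def)
  fix e :: nat assume "0 < e"
  show "qvar ^ e \<noteq> 1"
  proof
    assume "qvar ^ e = 1"
    hence "to_fract (Polynomial.monom (1 :: complex) e) = to_fract 1"
      by (simp add: qvar_power)
    hence "Polynomial.monom (1 :: complex) e = 1"
      unfolding to_fract_eq_iff .
    hence "Polynomial.degree (Polynomial.monom (1 :: complex) e) = 0" by simp
    thus False using \<open>0 < e\<close> by (simp add: degree_monom_eq)
  qed
qed

text \<open>A zero of \<open>1 - qvar ^ e\<close> at \<open>z\<close> is simple because the
  derivative there is \<open>- (of_nat e * z ^ (e - 1))\<close>, which is nonzero.\<close>

lemma cyclotomic_place_qvar:
  assumes n: "odd n" "3 \<le> n" and z: "\<And>e. z ^ e = 1 \<longleftrightarrow> n dvd e"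
  shows "cyclotomic_place qvar (place z) (to_fract [:- z, 1:]) n"
proof -
  interpret q_not_root_of_unity qvar by (rule q_not_root_of_unity_qvar)
  interpret local_subring "place z" "to_fract [:- z, 1:]" by (rule local_subring_place)
  have z0: "z \<noteq> 0"
    using z[of n] n by (auto simp: power_0_left)
  show ?thesis
  proof
    show "qvar \<in> place z"
      by (rule placeI[of 1 _ _ "[:0, 1:]"]) (simp_all add: qvar_def)
    show "1 / qvar \<in> place z"
      using z0 by (intro placeI[of "[:0, 1:]" _ _ 1]) (simp_all add: qvar_def)
    fix e :: nat assume e: "0 < e"
    define P :: "complex poly" where "P = 1 - Polynomial.monom 1 e"
    have P: "1 - qvar ^ e = to_fract P"
      by (simp add: P_def qvar_power)
    have nz: "1 - qvar ^ e \<noteq> 0"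
      using e by (rule one_minus_q_power_ne_0)
    have Pz: "poly P z = 1 - z ^ e"
      by (simp add: P_def poly_monom)
    show "ordeq (if n dvd e then 1 else 0) (1 - qvar ^ e)"
    proof (cases "n dvd e")
      case False
      hence "poly P z \<noteq> 0"
        using z[of e] by (simp add: Pz)
      hence "to_fract P \<in> place z" "1 / to_fract P \<in> place z"
        using placeI[of 1 z "to_fract P" P] placeI[of P z "1 / to_fract P" 1] by simp_all
      with False nz show ?thesis by (simp add: ordeq_def P)
    next
      case True
      hence "poly P z = 0"
        using z[of e] by (simp add: Pz)
      then obtain U where U: "P = [:- z, 1:] * U"
        by (auto simp: poly_eq_0_iff_dvd elim: dvdE)
      have "poly (pderiv P) z = poly U z"
        unfolding U pderiv_mult by (simp add: pderiv_pCons)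
      moreover have "poly (pderiv P) z = - (of_nat e * z ^ (e - 1))"
        by (simp add: P_def pderiv_diff pderiv_monom poly_monom)
      ultimately have Uz: "poly U z \<noteq> 0"
        using e z0 by auto
      have "to_fract P / to_fract [:- z, 1:] \<in> place z"
        unfolding U to_fract_mult by (intro placeI[of 1 _ _ U]) auto
      moreover have "to_fract [:- z, 1:] / to_fract P \<in> place z"
        using Uz unfolding U to_fract_mult by (intro placeI[of U _ _ 1]) auto
      ultimately show ?thesis
        using True nz by (simp add: ordeq_def P)
    qed
  qed (use n in auto)
qed

section \<open>From local orders to the congruence\<close>

lemma prime_elem_linear: "prime_elem [:- z, 1 :: complex:]"
  by (rule prime_elemI) (auto simp flip: poly_eq_0_iff_dvd simp: is_unit_pCons_iff)

text \<open>In lowest terms \<open>a / b\<close>, order two at \<open>z\<close> forces the squared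
  linear factor to divide \<open>a\<close>, hence to be coprime to \<open>b\<close>. Squares for
  distinct \<open>z\<close> are coprime, so their product divides \<open>a\<close>.\<close>

lemma ratfun_cong_prod_squaresI:
  assumes "finite Z"
    and ord: "\<And>z. z \<in> Z \<Longrightarrow> local_subring.ordge (place z) (to_fract [:- z, 1:]) 2 (A - B)"
  shows "ratfun_cong A B (\<Prod>z\<in>Z. [:- z, 1:] ^ 2)"
proof -
  define a where "a = fst (quot_of_fract (A - B))"
  define b where "b = snd (quot_of_fract (A - B))"
  have ab: "A - B = to_fract a / to_fract b" "b \<noteq> 0" "coprime a b"
    by (simp_all add: a_def b_def coprime_quot_of_fract flip: Fract_conv_to_fract)
  have dvd: "[:- z, 1:] ^ 2 dvd a" and cop: "coprime b ([:- z, 1:] ^ 2)" if z: "z \<in> Z" for z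
  proof -
    interpret local_subring "place z" "to_fract [:- z, 1:]" by (rule local_subring_place)
    obtain u v where uv: "poly v z \<noteq> 0" "(A - B) / to_fract [:- z, 1:] ^ 2 = to_fract u / to_fract v"
      using ord[OF z] unfolding ordge_def by (auto simp: place_def)
    have "v \<noteq> 0" using uv(1) by auto
    hence "to_fract (a * v) = to_fract ([:- z, 1:] ^ 2 * u * b)"
      using uv(2) ab(1,2) unfolding to_fract_mult to_fract_power by (simp add: divide_simps mult_ac)
    hence eq: "a * v = [:- z, 1:] ^ 2 * u * b"
      unfolding to_fract_eq_iff .
    have "\<not> [:- z, 1:] dvd v"
      using uv(1) by (simp add: poly_eq_0_iff_dvd)
    hence "coprime v ([:- z, 1:] ^ 2)"
      by (rule prime_elem_imp_power_coprime[OF prime_elem_linear])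
    moreover have "[:- z, 1:] ^ 2 dvd a * v"
      unfolding eq by (simp add: mult.assoc)
    ultimately show dvd: "[:- z, 1:] ^ 2 dvd a"
      by (simp add: coprime_commute coprime_dvd_mult_left_iff)
    have "coprime ([:- z, 1:] ^ 2) b"
      using ab(3) dvd by (rule coprime_divisors[of _ a _ b, rotated 2]) simp
    thus "coprime b ([:- z, 1:] ^ 2)"
      by (simp add: coprime_commute)
  qed
  have "(\<Prod>z\<in>Y. [:- z, 1:] ^ 2) dvd a" if "Y \<subseteq> Z" for Y
    using finite_subset[OF that assms(1)] that
  proof (induction Y rule: finite_induct)
    case (insert y Y)
    have "coprime ([:- y, 1:] ^ 2) (\<Prod>z\<in>Y. [:- z, 1:] ^ 2)"
    proof (rule prod_coprime_right)
      fix z assume "z \<in> Y"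
      hence "\<not> [:- z, 1:] dvd [:- y, 1:]"
        using insert.hyps by (auto simp flip: poly_eq_0_iff_dvd)
      hence "coprime [:- y, 1:] ([:- z, 1:] ^ 2)"
        by (rule prime_elem_imp_power_coprime[OF prime_elem_linear])
      thus "coprime ([:- y, 1:] ^ 2) ([:- z, 1:] ^ 2)"
        by simp
    qed
    moreover have "[:- y, 1:] ^ 2 dvd a" "(\<Prod>z\<in>Y. [:- z, 1:] ^ 2) dvd a"
      using insert dvd by auto
    ultimately show ?case
      using insert.hyps by (simp add: divides_mult)
  qed simp
  then obtain U where U: "a = (\<Prod>z\<in>Z. [:- z, 1:] ^ 2) * U"
    by (meson dvdE order_refl)
  have "coprime b (\<Prod>z\<in>Z. [:- z, 1:] ^ 2)"
    using cop by (rule prod_coprime_right)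
  moreover have "A - B = to_fract (\<Prod>z\<in>Z. [:- z, 1:] ^ 2) * to_fract U / to_fract b"
    unfolding ab(1) U to_fract_mult ..
  ultimately show ?thesis
    unfolding ratfun_cong_def using ab(2) by blast
qed

section \<open>Primitive roots and cyclotomic polynomials\<close>

definition primitive_roots :: "nat \<Rightarrow> complex set" where
  "primitive_roots N = (\<lambda>k. cis (2 * pi * real k / real N)) ` {k \<in> {1..N}. coprime k N}"

text \<open>The powers of \<open>w\<close> below \<open>N\<close> are distinct, so \<open>w\<close>
  has order \<open>N\<close>; coprimality then removes \<open>k\<close> from
  \<open>N dvd k * e\<close>.\<close>

lemma cis_power_eq_1_iff:
  assumes "0 < N" "coprime k N"
  shows "cis (2 * pi * real k / real N) ^ e = 1 \<longleftrightarrow> N dvd e"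
proof -
  define w where "w = cis (2 * pi / real N)"
  have w: "cis (2 * pi * real j / real N) = w ^ j" for j
    unfolding w_def DeMoivre by (simp add: mult_ac)
  have wN: "w ^ N = 1"
    using w[of N] assms(1) by simp
  have inj: "inj_on (\<lambda>j. w ^ j) {..<N}"
    using bij_betw_roots_unity[OF assms(1)] by (simp add: w bij_betw_def)
  have "w ^ j = w ^ (N * (j div N) + j mod N)" for j by simp
  hence wmod: "w ^ j = w ^ (j mod N)" for j
    unfolding power_add power_mult wN by (metis power_one mult_1)
  have "w ^ j = 1 \<longleftrightarrow> N dvd j" for j
  proof -
    have "w ^ j = 1 \<longleftrightarrow> w ^ (j mod N) = w ^ 0"
      using wmod[of j] by simp
    also have "\<dots> \<longleftrightarrow> j mod N = 0"
      using inj assms(1) by (subst inj_on_eq_iff[OF inj]) auto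
    finally show ?thesis by (simp add: dvd_eq_mod_eq_0)
  qed
  hence "w ^ (k * e) = 1 \<longleftrightarrow> N dvd k * e" .
  thus ?thesis
    using assms(2) by (simp add: w power_mult coprime_dvd_mult_right_iff coprime_commute)
qed

lemma primitive_roots_power_eq_1_iff:
  "z \<in> primitive_roots N \<Longrightarrow> z ^ e = 1 \<longleftrightarrow> N dvd e"
  unfolding primitive_roots_def using cis_power_eq_1_iff by fastforce

lemma finite_primitive_roots: "finite (primitive_roots N)"
  by (simp add: primitive_roots_def)

lemma cyclotomic_eq_prod:
  assumes "1 < N"
  shows "cyclotomic N = (\<Prod>z\<in>primitive_roots N. [:- z, 1:])"
proof -
  have "inj_on (\<lambda>k. cis (2 * pi * real k / real N)) {..<N}"
    using bij_betw_roots_unity[of N] assms by (simp add: bij_betw_def)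
  \<comment> \<open>For \<open>N > 1\<close> the index \<open>N\<close> is not coprime to itself, so
    all indices lie where the roots are known to be distinct.\<close>
  moreover have "{k \<in> {1..N}. coprime k N} \<subseteq> {..<N}"
    using assms by (auto simp: le_less)
  ultimately have "inj_on (\<lambda>k. cis (2 * pi * real k / real N)) {k \<in> {1..N}. coprime k N}"
    by (rule inj_on_subset)
  thus ?thesis
    by (simp add: cyclotomic_def primitive_roots_def prod.reindex o_def)
qed

lemma cyclotomic_squares_eq_prod:
  assumes "1 < n"
  shows "cyclotomic n ^ 2 * cyclotomic (n\<^sup>2) ^ 2 =
    (\<Prod>z\<in>primitive_roots n \<union> primitive_roots (n\<^sup>2). [:- z, 1:] ^ 2)"
proof -
  have "1 < n\<^sup>2"
    using assms by (intro one_less_power) simp_all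
  have "\<not> n\<^sup>2 dvd n"
    using assms by (auto dest!: dvd_imp_le simp: power2_eq_square)
  hence "primitive_roots n \<inter> primitive_roots (n\<^sup>2) = {}"
    using primitive_roots_power_eq_1_iff[of _ n n] primitive_roots_power_eq_1_iff[of _ "n\<^sup>2" n] by auto
  thus ?thesis
    using assms \<open>1 < n\<^sup>2\<close>
    by (simp add: cyclotomic_eq_prod prod.union_disjoint finite_primitive_roots prod_power_distrib)
qed

theorem theorem1p2:
  fixes n :: nat and q :: "complex poly fract"
  assumes "0 < n" and "[n = 3] (mod 4)"
  defines "q \<equiv> qvar"
  shows "ratfun_cong
           (\<Sum>k=0..(n\<^sup>2 - 1) div 2.
              (1 + q ^ (4 * k + 1)) * q_shifted (q ^ 2) (q ^ 4) k ^ 3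
                / ((1 + q) * q_shifted (q ^ 4) (q ^ 4) k ^ 3) * q ^ k)
           (q_integer (n\<^sup>2) (q ^ 2) * q_shifted (q ^ 3) (q ^ 4) ((n\<^sup>2 - 1) div 2)
              / q_shifted (q ^ 5) (q ^ 4) ((n\<^sup>2 - 1) div 2)
              * q powi ((1 - (int n)\<^sup>2) div 2))
           (cyclotomic n ^ 2 * cyclotomic (n\<^sup>2) ^ 2) \<and>
         ratfun_cong
           (\<Sum>k=0..n\<^sup>2 - 1.
              (1 + q ^ (4 * k + 1)) * q_shifted (q ^ 2) (q ^ 4) k ^ 3
                / ((1 + q) * q_shifted (q ^ 4) (q ^ 4) k ^ 3) * q ^ k)
           (q_integer (n\<^sup>2) (q ^ 2) * q_shifted (q ^ 3) (q ^ 4) ((n\<^sup>2 - 1) div 2)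
              / q_shifted (q ^ 5) (q ^ 4) ((n\<^sup>2 - 1) div 2)
              * q powi ((1 - (int n)\<^sup>2) div 2))
           (cyclotomic n ^ 2 * cyclotomic (n\<^sup>2) ^ 2)"
proof -
  interpret q: q_not_root_of_unity q
    unfolding q_def by (rule q_not_root_of_unity_qvar)
  have n4: "n mod 4 = 3"
    using assms(2) by (simp add: cong_def)
  hence n: "odd n" "3 \<le> n" "1 < n"
    by presburger+
  obtain g where g: "n = 2 * g + 1"
    using n(1) by (auto elim: oddE)
  define M where "M = (n\<^sup>2 - 1) div 2"
  \<comment> \<open>The limit \<open>M\<close> is thus the case \<open>H = g\<close> of
    \<open>ordge_sum_3_mod_4\<close>, whose largest node is \<open>N = n\<^sup>2\<close>.\<close>
  have M: "M = g * n + (n - 1) div 2" "2 * M + 1 = n\<^sup>2"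
    by (simp_all add: M_def g power2_eq_square algebra_simps)
  have N: "odd (n\<^sup>2)" "3 \<le> n\<^sup>2" "n\<^sup>2 mod 4 = 1"
  proof -
    show "odd (n\<^sup>2)" using n by simp
    show "3 \<le> n\<^sup>2" using n(2) by (simp add: power2_eq_square le_trans[OF n(2)])
    have "n\<^sup>2 mod 4 = (n mod 4)\<^sup>2 mod 4" by (simp add: power_mod)
    thus "n\<^sup>2 mod 4 = 1" by (simp add: n4)
  qed
  define S where "S L = (\<Sum>k\<le>L. q.summand 1 k)" for L
  have term_eq: "(1 + q ^ (4 * k + 1)) * q_shifted (q ^ 2) (q ^ 4) k ^ 3
                / ((1 + q) * q_shifted (q ^ 4) (q ^ 4) k ^ 3) * q ^ k = q.summand 1 k" for k
    by (simp add: q.summand_def q.outer_def power3_eq_cube mult_ac)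
  have "(1 - (int n)\<^sup>2) div 2 = - int M"
    using M(2) by (simp flip: of_nat_power)
  hence rhs: "q_integer (n\<^sup>2) (q ^ 2) * q_shifted (q ^ 3) (q ^ 4) M / q_shifted (q ^ 5) (q ^ 4) M
      * q powi ((1 - (int n)\<^sup>2) div 2) = q.closed_form M"
    unfolding q.closed_form_def M(2) by (simp add: power_int_minus divide_inverse)
  have main: "local_subring.ordge (place z) (to_fract [:- z, 1:]) 2 (S L - q.closed_form M)"
    if z: "z \<in> primitive_roots n \<union> primitive_roots (n\<^sup>2)" and L: "L = M \<or> L = n\<^sup>2 - 1" for z L
    using z
  proof
    assume "z \<in> primitive_roots n"
    then interpret cyclotomic_place q "place z" "to_fract [:- z, 1:]" n
      unfolding q_def using n by (intro cyclotomic_place_qvar primitive_roots_power_eq_1_iff)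
    \<comment> \<open>At order \<open>n\<close> the two sides vanish doubly, each on its
      own.\<close>
    have rhs: "ordge 2 (q.closed_form M)"
      unfolding M(1) using n4 by (rule ordge_closed_form_3_mod_4)
    have "ordge 2 (S L)"
      using L
    proof
      assume "L = M"
      thus ?thesis
        unfolding S_def M(1) using ordge_sum_3_mod_4[OF n4] by simp
    next
      assume "L = n\<^sup>2 - 1"
      \<comment> \<open>\<open>H = n - 1\<close> gives the last limit of this shape below
        \<open>n\<^sup>2\<close>; the remaining indices lie in the upper half of the final block,
        where terms have order two.\<close>
      define L' where "L' = (n - 1) * n + (n - 1) div 2"
      have sq: "n\<^sup>2 = (n - 1) * n + n"
        using n by (simp add: power2_eq_square algebra_simps)
      have "ordge 2 ((\<Sum>k\<le>L. q.summand 1 k) - 0)"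
      proof (rule ordge_sum_extend)
        show "ordge 2 ((\<Sum>k\<le>L'. q.summand 1 k) - 0)"
          unfolding L'_def using ordge_sum_3_mod_4[OF n4] by simp
        show "L' \<le> L"
          unfolding L'_def \<open>L = n\<^sup>2 - 1\<close> sq using n by linarith
        fix k assume "L' < k" "k \<le> L"
        hence k: "(n - 1) * n + (n - 1) div 2 < k" "k < (n - 1) * n + n"
          unfolding L'_def \<open>L = n\<^sup>2 - 1\<close> sq using n by linarith+
        define r where "r = k - (n - 1) * n"
        have "k = r + (n - 1) * n" "(n - 1) div 2 < r" "r < n"
          using k unfolding r_def by linarith+
        thus "(n - 1) div 2 < k mod n"
          by (metis mod_mult_self1 mod_less)
      qed
      thus ?thesis by (simp add: S_def)
    qed
    thus ?thesis
      using rhs by (rule ordge_diff)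
  next
    \<comment> \<open>Here \<open>n\<^sup>2\<close>, which is 1 modulo 4, plays the role of
      \<open>n\<close>, and every index beyond \<open>M\<close> is in the upper half of the only
      block.\<close>
    assume "z \<in> primitive_roots (n\<^sup>2)"
    then interpret cyclotomic_place q "place z" "to_fract [:- z, 1:]" "n\<^sup>2"
      unfolding q_def using N by (intro cyclotomic_place_qvar primitive_roots_power_eq_1_iff)
    have base: "ordge 2 ((\<Sum>k\<le>M. q.summand 1 k) - q.closed_form M)"
      unfolding M_def using N(3) by (rule ordge_sum_1_mod_4)
    show ?thesis
      unfolding S_def using base
    proof (rule ordge_sum_extend)
      show "M \<le> L"
        using L by (auto simp: M_def)
      fix k assume "M < k" "k \<le> L"
      moreover have "k < n\<^sup>2"
        using \<open>k \<le> L\<close> L M(2) N(2) by linarith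
      ultimately show "(n\<^sup>2 - 1) div 2 < k mod n\<^sup>2"
        unfolding M_def by simp
    qed
  qed
  have "ratfun_cong (S L) (q.closed_form M) (cyclotomic n ^ 2 * cyclotomic (n\<^sup>2) ^ 2)"
    if "L = M \<or> L = n\<^sup>2 - 1" for L
    unfolding cyclotomic_squares_eq_prod[OF n(3)]
    using main that by (intro ratfun_cong_prod_squaresI) (auto simp: finite_primitive_roots)
  from this[of M] this[of "n\<^sup>2 - 1"] show ?thesis
    unfolding term_eq M_def[symmetric] rhs atLeast0AtMost S_def by simp
qed

end
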